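(* Assume the Browkin-Brzezinski conjecture: for every integer $n>2$ and every $\epsilon>0$ there exists a constant $C_{n,\epsilon}$ such that for all integers $a_1,\dots,a_n$ with $a_1+\cdots+a_n=0$, with no proper nonempty subset of the $a_i$ having zero sum, and with $\gcd(a_1,\dots,a_n)=1$, one has $$\max(|a_1|,\dots,|a_n|)\le C_{n,\epsilon}\,\bigl(\mathrm{rad}(a_1\cdots a_n)\bigr)^{2n-5+\epsilon}.$$ Then there exist infinitely many pairs of distinct primes $p_1$ and $p_2$ such that the ring $\mathbb{Z}\left[\frac{1}{p_1},\frac{1}{p_2}\right]$ does not have a 4-cycle.
   Context: For a nonzero integer $N$, $\mathrm{rad}(N)$ is the product of the distinct prime factors of $N$. For a ring $R$ and $f\in R[x]$, a 4-cycle of $f$ is a sequence $(x_1,x_2,x_3,x_4)$ of four distinct elements of $R$ with $f(x_1)=x_2$, $f(x_2)=x_3$, $f(x_3)=x_4$, $f(x_4)=x_1$. The ring $R$ has a 4-cycle if some polynomial $f\in R[x]$ has a 4-cycle in $R$. *)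

theory Defs
  imports Complex_Main "HOL-Computational_Algebra.Primes" "HOL-Computational_Algebra.Polynomial"
begin

text \<open>Only meaningful for \<open>N \<noteq> 0\<close>; \<^const>\<open>prime_factors\<close> of an integer consists of positive primes.\<close>

definition rad :: "int \<Rightarrow> int" where
  "rad N = \<Prod>(prime_factors N)"

text \<open>Subsets of the \<open>a\<^sub>i\<close> are taken as sets of indices. Since \<open>n > 2\<close>, the condition on
  singletons forces every \<open>a\<^sub>i\<close> to be nonzero, so \<open>rad\<close> is applied to a nonzero integer.\<close>

definition Browkin_Brzezinski_conjecture :: bool where
  "Browkin_Brzezinski_conjecture \<longleftrightarrow>
     (\<forall>n::nat. n > 2 \<longrightarrow> (\<forall>\<epsilon>::real. \<epsilon> > 0 \<longrightarrow> (\<exists>C::real. \<forall>a :: nat \<Rightarrow> int.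
        (\<Sum>i=1..n. a i) = 0 \<longrightarrow>
        (\<forall>I. I \<noteq> {} \<and> I \<subset> {1..n} \<longrightarrow> (\<Sum>i\<in>I. a i) \<noteq> 0) \<longrightarrow>
        Gcd (a ` {1..n}) = 1 \<longrightarrow>
        real_of_int (Max ((\<lambda>i. \<bar>a i\<bar>) ` {1..n}))
          \<le> C * real_of_int (rad (\<Prod>i=1..n. a i)) powr (2 * real n - 5 + \<epsilon>))))"

text \<open>\<open>int_adjoin S\<close> is \<open>\<int>[S]\<close>: the smallest subring (with 1) of the ambient ring that contains \<open>S\<close>.\<close>

inductive_set int_adjoin :: "'a::comm_ring_1 set \<Rightarrow> 'a set" for S :: "'a set" where
  one: "1 \<in> int_adjoin S"
| incl: "s \<in> S \<Longrightarrow> s \<in> int_adjoin S"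
| diff: "x \<in> int_adjoin S \<Longrightarrow> y \<in> int_adjoin S \<Longrightarrow> x - y \<in> int_adjoin S"
| mult: "x \<in> int_adjoin S \<Longrightarrow> y \<in> int_adjoin S \<Longrightarrow> x * y \<in> int_adjoin S"

text \<open>The ring \<open>R\<close> is given as a subring of an ambient ring \<open>'a\<close>; elements of \<open>R[x]\<close> are the
  polynomials over \<open>'a\<close> all of whose coefficients lie in \<open>R\<close>.\<close>

definition is_four_cycle :: "'a::comm_ring_1 set \<Rightarrow> 'a poly \<Rightarrow> 'a \<times> 'a \<times> 'a \<times> 'a \<Rightarrow> bool" where
  "is_four_cycle R f = (\<lambda>(x1, x2, x3, x4).
     {x1, x2, x3, x4} \<subseteq> R \<and> distinct [x1, x2, x3, x4] \<and>
     poly f x1 = x2 \<and> poly f x2 = x3 \<and> poly f x3 = x4 \<and> poly f x4 = x1)"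

definition has_four_cycle :: "'a::comm_ring_1 set \<Rightarrow> bool" where
  "has_four_cycle R \<longleftrightarrow> (\<exists>f. (\<forall>i. coeff f i \<in> R) \<and> (\<exists>c. is_four_cycle R f c))"

end

(* Fix p1 = 5 and let q = p2 vary. Consecutive differences of a 4-cycle divide each other
   cyclically, so after scaling they are units 1, u1, u2, u3 with sum zero. Distinctness and a parity
   argument exclude vanishing subsums, so clearing denominators gives a relation
   s1 5^e1 q^f1 + ... + s4 5^e4 q^f4 = 0 (si = 1 or -1) to which the conjecture with n = 4 applies:
   the exponents are O(log q). For fixed signs and exponents, q is a root of a polynomial, which is
   nonzero because otherwise all fi vanish and, modulo 5, so do all ei. Hence only polylogarithmically
   many q up to 2^k can admit a 4-cycle, while the number of primes up to 2^k is at least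
   (2^k - 1) / k because lcm(1, ..., n + 1) is at least 2^n. *)

theory Submission
  imports Defs "HOL-Library.FuncSet" "HOL-Real_Asymp.Real_Asymp"
begin

section \<open>Lower bound for the number of primes up to 2^k\<close>

text \<open>The numbers 1 / ((n+1) C(n,k)) form Leibniz's harmonic triangle: the entry (n, k+1) is
  the entry (n-1, k) minus the entry (n, k). By induction on k every entry of row n is an integral
  combination of 1/1, ..., 1/(n+1), so D times it is an integer.\<close>

lemma Suc_times_binomial_dvd:
  assumes "k \<le> n" "\<And>j. j \<in> {1..Suc n} \<Longrightarrow> j dvd D"
  shows "Suc n * (n choose k) dvd D"
proof -
  have "of_nat D / (of_nat (Suc n) * of_nat (n choose k) :: rat) \<in> \<int>"
    using assms
  proof (induction k arbitrary: n)
    case 0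
    then have "Suc n dvd D" by simp
    then obtain m where "D = Suc n * m" by blast
    then have "of_nat D / (of_nat (Suc n) * of_nat (n choose 0) :: rat) = of_nat m"
      by (simp del: of_nat_Suc mult_Suc)
    then show ?case by simp
  next
    case (Suc k)
    then obtain m where n: "n = Suc m" by (cases n) auto
    have km: "k \<le> m" using Suc.prems n by simp
    have pos: "m choose k > 0" "n choose k > 0" "n choose Suc k > 0"
      using km n Suc.prems by auto
    have e1: "Suc k * (Suc n choose Suc k) = Suc n * (n choose k)"
      by (rule Suc_times_binomial)
    have e2: "Suc k * (n choose Suc k) = n * (m choose k)"
      unfolding n by (rule Suc_times_binomial)
    define A B where "A = (of_nat (n choose k) :: rat)" and "B = (of_nat (n choose Suc k) :: rat)"
    have AB: "A > 0" "B > 0" using pos by (auto simp: A_def B_def)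
    have e1': "of_nat (Suc k) * (A + B) = of_nat (Suc n) * A"
      using arg_cong[OF e1, of "of_nat :: nat \<Rightarrow> rat"] unfolding A_def B_def
      by (simp add: algebra_simps)
    have e2': "of_nat n * of_nat (m choose k) = of_nat (Suc k) * B"
      using arg_cong[OF e2, of "of_nat :: nat \<Rightarrow> rat"] unfolding B_def
      by (simp only: of_nat_mult)
    \<comment> \<open>The sum of the reciprocals of A and B has numerator A + B, which
      \<open>e1'\<close> cancels; \<open>e2'\<close> recognises the rest as an entry of row
      m.\<close>
    have "of_nat D / (of_nat (Suc n) * B) + of_nat D / (of_nat (Suc n) * A)
        = of_nat D * (A + B) / (of_nat (Suc n) * A * B)"
      using AB by (simp add: divide_simps del: of_nat_Suc) (simp add: algebra_simps)
    also have "\<dots> = of_nat D * (A + B) / (of_nat (Suc k) * (A + B) * B)"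
      unfolding e1' by simp
    also have "\<dots> = of_nat D / (of_nat (Suc k) * B)"
      using AB by (simp add: divide_simps del: of_nat_Suc)
    also have "\<dots> = of_nat D / (of_nat (Suc m) * of_nat (m choose k))"
      unfolding e2'[symmetric] n ..
    finally have eq: "of_nat D / (of_nat (Suc n) * B) =
      of_nat D / (of_nat (Suc m) * of_nat (m choose k)) - of_nat D / (of_nat (Suc n) * A)"
      by simp
    have "of_nat D / (of_nat (Suc n) * A) \<in> \<int>"
      unfolding A_def using Suc.prems by (intro Suc.IH) auto
    moreover have "of_nat D / (of_nat (Suc m) * of_nat (m choose k) :: rat) \<in> \<int>"
      using Suc.prems n by (intro Suc.IH) auto
    ultimately show ?case using eq unfolding B_def by (metis Ints_diff)
  qed
  then obtain z where "of_nat D / (of_nat (Suc n) * of_nat (n choose k) :: rat) = of_int z"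
    by (auto elim: Ints_cases)
  moreover have "n choose k > 0" using assms(1) by simp
  ultimately have "(of_nat D :: rat) = of_int z * (of_nat (Suc n) * of_nat (n choose k))"
    by (simp add: field_simps del: of_nat_Suc)
  then have "of_int (int D) = (of_int (z * int (Suc n * (n choose k))) :: rat)"
    by (simp add: algebra_simps)
  then have "int D = z * int (Suc n * (n choose k))" unfolding of_int_eq_iff .
  then show ?thesis by (metis dvd_triv_right int_dvd_int_iff)
qed

text \<open>The n+1 numbers (n+1) C(n,k) divide D, so each is at most D, while their sum is (n+1)
  2^n.\<close>

lemma two_power_le_common_multiple:
  assumes "\<And>j. j \<in> {1..Suc n} \<Longrightarrow> j dvd D" "D > 0"
  shows "2 ^ n \<le> (D :: nat)"
proof -
  have "Suc n * 2 ^ n = (\<Sum>k\<le>n. Suc n * (n choose k))"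
    by (simp only: choose_row_sum[symmetric] sum_distrib_left)
  also have "\<dots> \<le> (\<Sum>k\<le>n. D)"
  proof (rule sum_mono)
    fix k assume "k \<in> {..n}"
    then have "Suc n * (n choose k) dvd D" using assms by (intro Suc_times_binomial_dvd) auto
    then show "Suc n * (n choose k) \<le> D" using assms(2) by (rule dvd_imp_le)
  qed
  also have "\<dots> = Suc n * D" by simp
  finally show ?thesis unfolding mult_le_cancel1 by simp
qed

text \<open>The previous bound is applied to lcm(1, ..., N) with N = n+1, written as the product
  over primes p of the largest power of p not exceeding N. Each factor is at most N, and there is
  one factor per prime.\<close>

lemma two_power_le_power_prime_count:
  "2 ^ n \<le> Suc n ^ card {p. prime p \<and> p \<le> Suc n}"
proof -
  define N where "N = Suc n"
  \<comment> \<open>A greatest exponent is guaranteed only when the admissible ones are bounded;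
    \<open>bound\<close> supplies this for primes, and \<open>E\<close> is used only there.\<close>
  define E where "E p = (GREATEST e. p ^ e \<le> N)" for p :: nat
  define Pr where "Pr = {p. prime p \<and> p \<le> N}"
  have fin: "finite Pr" unfolding Pr_def by simp
  have bound: "e \<le> N" if "p ^ e \<le> N" "prime p" for p e :: nat
  proof -
    have "e < 2 ^ e" by (rule less_exp)
    also have "\<dots> \<le> p ^ e" using prime_ge_2_nat[OF that(2)] by (intro power_mono) auto
    finally show ?thesis using that by simp
  qed
  have E1: "p ^ E p \<le> N" if "prime p" for p
    unfolding E_def by (rule GreatestI_nat[of _ 0 N]) (use bound that in \<open>auto simp: N_def\<close>)
  have E2: "e \<le> E p" if "prime p" "p ^ e \<le> N" for p e
    unfolding E_def by (rule Greatest_le_nat[of _ e N]) (use bound that in auto)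
  define D where "D = (\<Prod>p\<in>Pr. p ^ E p)"
  have "D > 0" unfolding D_def by (rule prod_pos) (auto simp: Pr_def prime_gt_0_nat)
  have "2 ^ n \<le> D"
  proof (rule two_power_le_common_multiple)
    fix j assume j: "j \<in> {1..Suc n}"
    have "j = (\<Prod>p\<in>prime_factors j. p ^ multiplicity p j)"
      using j by (intro prime_factorization_nat) auto
    also have "\<dots> dvd D" unfolding D_def
    proof (rule prod_dvd_prod_subset2[OF fin])
      show "prime_factors j \<subseteq> Pr"
        using j by (auto simp: Pr_def N_def in_prime_factors_iff dest!: dvd_imp_le)
      fix p assume p: "p \<in> prime_factors j"
      have "p ^ multiplicity p j \<le> j" using j by (intro dvd_imp_le multiplicity_dvd) simp
      also have "\<dots> \<le> N" using j by (simp add: N_def)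
      finally have "p ^ multiplicity p j \<le> N" .
      then show "p ^ multiplicity p j dvd p ^ E p"
        using p E2 by (intro le_imp_power_dvd) auto
    qed
    finally show "j dvd D" .
  qed fact
  also have "D \<le> (\<Prod>p\<in>Pr. N)" unfolding D_def
    by (rule prod_mono) (use E1 in \<open>auto simp: Pr_def\<close>)
  finally show ?thesis by (simp add: Pr_def N_def)
qed

text \<open>The choice n = 2^k - 1 makes both sides powers of 2, and the exponents are compared. The
  summand 1 on the right avoids a truncated subtraction.\<close>

lemma prime_count_two_power:
  "2 ^ k \<le> k * card {p. prime p \<and> p \<le> (2 ^ k :: nat)} + 1"
proof -
  have "(2::nat) ^ (2 ^ k - 1) \<le> (2 ^ k) ^ card {p. prime p \<and> p \<le> (2 ^ k :: nat)}"
    using two_power_le_power_prime_count[of "2 ^ k - 1"] by simp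
  then have "(2::nat) ^ k - 1 \<le> k * card {p. prime p \<and> p \<le> (2 ^ k :: nat)}"
    unfolding power_mult[symmetric] by (subst (asm) power_increasing_iff) auto
  then show ?thesis by linarith
qed

section \<open>Divisibility and units in Z[S], and the unit equation of a 4-cycle\<close>

lemma int_adjoin_zero: "0 \<in> int_adjoin S"
  using int_adjoin.diff[OF int_adjoin.one int_adjoin.one] by simp

lemma int_adjoin_add: "x \<in> int_adjoin S \<Longrightarrow> y \<in> int_adjoin S \<Longrightarrow> x + y \<in> int_adjoin S"
  using int_adjoin.diff[of x S "0 - y"] int_adjoin.diff[OF int_adjoin_zero, of y S] by simp

lemma poly_in_int_adjoin:
  assumes "\<And>i. coeff f i \<in> int_adjoin S" "x \<in> int_adjoin S"
  shows "poly f x \<in> int_adjoin S"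
  using assms(1)
proof (induction f)
  case 0
  then show ?case by (simp add: int_adjoin_zero)
next
  case (pCons a f)
  have "a \<in> int_adjoin S" using pCons.prems[of 0] by simp
  moreover have "poly f x \<in> int_adjoin S"
    using pCons.prems[of "Suc _"] by (intro pCons.IH) simp
  ultimately show ?case using assms(2) by (auto intro: int_adjoin_add int_adjoin.mult)
qed

text \<open>This is the source of all divisibilities between differences of cycle elements. The
  point is that the cofactor lies in the subring, which follows from Horner's scheme.\<close>

lemma poly_diff_dvd_in_int_adjoin:
  assumes "\<And>i. coeff f i \<in> int_adjoin S" "x \<in> int_adjoin S" "y \<in> int_adjoin S"
  shows "\<exists>c\<in>int_adjoin S. poly f x - poly f y = (x - y) * c"
  using assms(1)
proof (induction f)
  case 0
  then show ?case using int_adjoin_zero[of S] by (intro bexI[of _ 0]) simp_all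
next
  case (pCons a f)
  have f: "coeff f i \<in> int_adjoin S" for i using pCons.prems[of "Suc i"] by simp
  then obtain c where c: "c \<in> int_adjoin S" "poly f x - poly f y = (x - y) * c"
    using pCons.IH by blast
  have "poly (pCons a f) x - poly (pCons a f) y = x * (poly f x - poly f y) + (x - y) * poly f y"
    by (simp add: algebra_simps)
  also have "\<dots> = (x - y) * (x * c + poly f y)" by (simp add: c(2) algebra_simps)
  finally show ?case
    using c(1) assms f by (blast intro: int_adjoin_add int_adjoin.mult poly_in_int_adjoin)
qed

text \<open>The inverse has to lie in the subring itself: in the ambient field of rationals every
  nonzero element is invertible.\<close>

definition int_adjoin_unit :: "'a::comm_ring_1 set \<Rightarrow> 'a \<Rightarrow> bool" where
  "int_adjoin_unit S u \<longleftrightarrow> u \<in> int_adjoin S \<and> (\<exists>v\<in>int_adjoin S. u * v = 1)"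

lemma int_adjoin_unit_mult:
  assumes "int_adjoin_unit S u" "int_adjoin_unit S v"
  shows "int_adjoin_unit S (u * v)"
proof -
  obtain u' v' where "u' \<in> int_adjoin S" "u * u' = 1" "v' \<in> int_adjoin S" "v * v' = 1"
    using assms unfolding int_adjoin_unit_def by blast
  moreover have "(u * v) * (u' * v') = (u * u') * (v * v')" by (simp only: mult_ac)
  ultimately show ?thesis using assms
    unfolding int_adjoin_unit_def
    by (intro conjI bexI[of _ "u' * v'"]) (simp_all add: int_adjoin.mult)
qed

lemma int_adjoin_unitI:
  assumes "u \<in> int_adjoin S" "v \<in> int_adjoin S" "u * v = 1"
  shows "int_adjoin_unit S u"
  using assms unfolding int_adjoin_unit_def by blast

text \<open>Each of x2 - x1, x3 - x2, x4 - x3, x1 - x4 divides the next one cyclically, so the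
  quotients are units; dividing by x2 - x1 turns the four differences into 1, u1, u2, u3. The
  diagonals x3 - x1 and x4 - x2 become 1 + u1 and u1 + u2. They divide each other, which gives the
  unit w needed later to exclude 1 + u2 = 0.\<close>

lemma four_cycle_imp_unit_equation:
  fixes S :: "'a::idom set"
  assumes "has_four_cycle (int_adjoin S)"
  obtains u1 u2 u3 w where
    "int_adjoin_unit S u1" "int_adjoin_unit S u2" "int_adjoin_unit S u3" "int_adjoin_unit S w"
    "1 + u1 + u2 + u3 = 0" "1 + u1 \<noteq> 0" "u1 + u2 \<noteq> 0" "u1 + u2 = (1 + u1) * w"
proof -
  obtain f x1 x2 x3 x4 where f: "\<And>i. coeff f i \<in> int_adjoin S"
    and "is_four_cycle (int_adjoin S) f (x1, x2, x3, x4)"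
    using assms unfolding has_four_cycle_def by (metis prod_cases4)
  then have x: "x1 \<in> int_adjoin S" "x2 \<in> int_adjoin S" "x3 \<in> int_adjoin S" "x4 \<in> int_adjoin S"
    and d: "distinct [x1, x2, x3, x4]"
    and fx: "poly f x1 = x2" "poly f x2 = x3" "poly f x3 = x4" "poly f x4 = x1"
    unfolding is_four_cycle_def by auto
  obtain c1 where c1: "c1 \<in> int_adjoin S" "x3 - x2 = (x2 - x1) * c1"
    using poly_diff_dvd_in_int_adjoin[OF f x(2) x(1)] fx by auto
  obtain c2 where c2: "c2 \<in> int_adjoin S" "x4 - x3 = (x3 - x2) * c2"
    using poly_diff_dvd_in_int_adjoin[OF f x(3) x(2)] fx by auto
  obtain c3 where c3: "c3 \<in> int_adjoin S" "x1 - x4 = (x4 - x3) * c3"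
    using poly_diff_dvd_in_int_adjoin[OF f x(4) x(3)] fx by auto
  obtain c4 where c4: "c4 \<in> int_adjoin S" "x2 - x1 = (x1 - x4) * c4"
    using poly_diff_dvd_in_int_adjoin[OF f x(1) x(4)] fx by auto
  obtain w where w: "w \<in> int_adjoin S" "x4 - x2 = (x3 - x1) * w"
    using poly_diff_dvd_in_int_adjoin[OF f x(3) x(1)] fx by auto
  obtain w' where w': "w' \<in> int_adjoin S" "x1 - x3 = (x4 - x2) * w'"
    using poly_diff_dvd_in_int_adjoin[OF f x(4) x(2)] fx by auto
  define \<delta> where "\<delta> = x2 - x1"
  have \<delta>: "\<delta> \<noteq> 0" using d by (auto simp: \<delta>_def)
  have d2: "x3 - x2 = \<delta> * c1" using c1 by (simp add: \<delta>_def)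
  have d3: "x4 - x3 = \<delta> * (c1 * c2)" using c2 d2 by (simp add: mult.assoc)
  have d4: "x1 - x4 = \<delta> * (c1 * c2 * c3)" using c3 d3 by (simp add: mult.assoc)
  have "\<delta> * (c1 * c2 * c3 * c4) = \<delta>" using c4 d4 by (simp add: \<delta>_def mult.assoc)
  then have c: "c1 * c2 * c3 * c4 = 1" using \<delta> by simp
  \<comment> \<open>Applying f twice to the pair (x3, x1) exchanges its entries, so w w' = -1 and
    the inverse of w is -w'.\<close>
  have "(x3 - x1) * (w * (0 - w')) = - ((x3 - x1) * w * w')" by (simp add: mult.assoc)
  also have "\<dots> = x3 - x1" unfolding w(2)[symmetric] w'(2)[symmetric] by simp
  finally have "(x3 - x1) * (w * (0 - w')) = x3 - x1" .
  moreover have "x3 - x1 \<noteq> 0" using d by auto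
  ultimately have ww: "w * (0 - w') = 1" unfolding mult_cancel_left2 by simp
  have U: "int_adjoin_unit S c1" "int_adjoin_unit S c2" "int_adjoin_unit S c3" "int_adjoin_unit S w"
  proof -
    show "int_adjoin_unit S c1"
      by (rule int_adjoin_unitI[of _ _ "c2 * c3 * c4"]) 
         (use c1 c2 c3 c4 c in \<open>auto intro!: int_adjoin.mult simp: mult_ac\<close>)
    show "int_adjoin_unit S c2"
      by (rule int_adjoin_unitI[of _ _ "c1 * c3 * c4"])
         (use c1 c2 c3 c4 c in \<open>auto intro!: int_adjoin.mult simp: mult_ac\<close>)
    show "int_adjoin_unit S c3"
      by (rule int_adjoin_unitI[of _ _ "c1 * c2 * c4"])
         (use c1 c2 c3 c4 c in \<open>auto intro!: int_adjoin.mult simp: mult_ac\<close>)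
    show "int_adjoin_unit S w"
      by (rule int_adjoin_unitI[OF w(1) _ ww]) (intro int_adjoin.diff int_adjoin_zero w')
  qed
  show ?thesis
  proof (rule that)
    show "int_adjoin_unit S c1" "int_adjoin_unit S (c1 * c2)" "int_adjoin_unit S (c1 * c2 * c3)"
      "int_adjoin_unit S w" using U by (auto intro!: int_adjoin_unit_mult)
    have "\<delta> * (1 + c1 + c1 * c2 + c1 * c2 * c3) = (x2 - x1) + (x3 - x2) + (x4 - x3) + (x1 - x4)"
      unfolding d2 d3 d4 by (simp add: \<delta>_def algebra_simps)
    then show "1 + c1 + c1 * c2 + c1 * c2 * c3 = 0" using \<delta> by simp
    have e1: "\<delta> * (1 + c1) = x3 - x1"
      using d2 by (simp add: \<delta>_def algebra_simps)
    then show "1 + c1 \<noteq> 0" using d by auto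
    have e2: "\<delta> * (c1 + c1 * c2) = x4 - x2"
      using d2 d3 by (simp add: algebra_simps)
    then show "c1 + c1 * c2 \<noteq> 0" using d by auto
    have "\<delta> * (c1 + c1 * c2) = \<delta> * ((1 + c1) * w)"
      using e1 e2 w by (simp flip: mult.assoc)
    then show "c1 + c1 * c2 = (1 + c1) * w" using \<delta> by simp
  qed
qed

section \<open>Units of Z[1/p, 1/q]\<close>

context
  fixes p q :: nat
  assumes pq: "p > 0" "q > 0"
begin

lemma int_adjoin_inverse_pair_form:
  assumes "x \<in> int_adjoin {1 / of_nat p :: rat, 1 / of_nat q}"
  shows "\<exists>n k. x * of_nat ((p * q) ^ k) = of_int n"
  using assms
proof induction
  case one
  show ?case by (rule exI[of _ 1], rule exI[of _ 0]) simp
next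
  case (incl s)
  then consider "s = 1 / of_nat p" | "s = 1 / of_nat q" by blast
  then show ?case
  proof cases
    case 1
    show ?thesis by (rule exI[of _ "int q"], rule exI[of _ 1]) (use 1 pq in simp)
  next
    case 2
    show ?thesis by (rule exI[of _ "int p"], rule exI[of _ 1]) (use 2 pq in simp)
  qed
next
  case (diff x y)
  then obtain n k m l where "x * of_nat ((p * q) ^ k) = of_int n" "y * of_nat ((p * q) ^ l) = of_int m"
    by blast
  moreover have "(x - y) * of_nat ((p * q) ^ (k + l)) =
     x * of_nat ((p * q) ^ k) * of_nat ((p * q) ^ l) - y * of_nat ((p * q) ^ l) * of_nat ((p * q) ^ k)"
    by (simp add: power_add algebra_simps)
  ultimately have "(x - y) * of_nat ((p * q) ^ (k + l)) =
     of_int (n * int ((p * q) ^ l) - m * int ((p * q) ^ k))"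
    by simp
  then show ?case by blast
next
  case (mult x y)
  then obtain n k m l where "x * of_nat ((p * q) ^ k) = of_int n" "y * of_nat ((p * q) ^ l) = of_int m"
    by blast
  moreover have "(x * y) * of_nat ((p * q) ^ (k + l)) =
     (x * of_nat ((p * q) ^ k)) * (y * of_nat ((p * q) ^ l))"
    by (simp add: power_add algebra_simps)
  ultimately have "(x * y) * of_nat ((p * q) ^ (k + l)) = of_int (n * m)"
    by simp
  then show ?case by blast
qed

text \<open>Clearing denominators in u v = 1 writes a power of p q as a product of two integers, one
  of them the numerator of u.\<close>

lemma int_adjoin_unit_inverse_pair_form:
  assumes "int_adjoin_unit {1 / of_nat p :: rat, 1 / of_nat q} u"
  obtains n k l where "u * of_nat ((p * q) ^ k) = of_int n" "n dvd int ((p * q) ^ l)"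
proof -
  obtain v where uv: "u \<in> int_adjoin {1 / of_nat p :: rat, 1 / of_nat q}"
    "v \<in> int_adjoin {1 / of_nat p :: rat, 1 / of_nat q}" "u * v = 1"
    using assms unfolding int_adjoin_unit_def by blast
  then obtain n k m l where nk: "u * of_nat ((p * q) ^ k) = of_int n"
    and ml: "v * of_nat ((p * q) ^ l) = of_int m"
    using int_adjoin_inverse_pair_form by meson
  have "(of_int (n * m) :: rat) = (u * v) * (of_nat ((p * q) ^ k) * of_nat ((p * q) ^ l))"
    unfolding of_int_mult nk[symmetric] ml[symmetric] by (simp only: mult_ac)
  also have "\<dots> = of_int (int ((p * q) ^ (k + l)))"
    unfolding uv(3) by (simp add: power_add)
  finally have "n * m = int ((p * q) ^ (k + l))" unfolding of_int_eq_iff .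
  then have "n dvd int ((p * q) ^ (k + l))" by (metis dvd_triv_left)
  with nk show ?thesis by (rule that)
qed

text \<open>If \<open>u = n / D\<close> and \<open>w = m / E\<close> with all four numbers odd, then the equation reads
  \<open>E (n - D) = m (n + D)\<close>, but exactly one of \<open>n - D\<close> and \<open>n + D\<close> is divisible by 4.\<close>

lemma odd_unit_relation_impossible:
  assumes "odd p" "odd q"
    and "int_adjoin_unit {1 / of_nat p :: rat, 1 / of_nat q} u"
    and "int_adjoin_unit {1 / of_nat p :: rat, 1 / of_nat q} w"
  shows "u - 1 \<noteq> (1 + u) * w"
proof
  assume eq: "u - 1 = (1 + u) * w"
  obtain n k l where n: "u * of_nat ((p * q) ^ k) = of_int n" "n dvd int ((p * q) ^ l)"
    using int_adjoin_unit_inverse_pair_form[OF assms(3)] .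
  obtain m k' l' where m: "w * of_nat ((p * q) ^ k') = of_int m" "m dvd int ((p * q) ^ l')"
    using int_adjoin_unit_inverse_pair_form[OF assms(4)] .
  define D E where "D = int ((p * q) ^ k)" and "E = int ((p * q) ^ k')"
  have "odd (int ((p * q) ^ j))" for j using assms(1,2) by simp
  then have "odd n" "odd m" using n(2) m(2) dvd_trans by blast+
  moreover have "odd D" "odd E" using assms(1,2) by (auto simp: D_def E_def)
  ultimately obtain a b where ab: "n = 2 * a + 1" "D = 2 * b + 1" by (meson oddE)
  have uD: "u * of_int D = of_int n" and wE: "w * of_int E = of_int m"
    using n m by (simp_all add: D_def E_def)
  have "(of_int (E * (n - D)) :: rat) = of_int E * of_int D * (u - 1)"
    using uD by (simp add: algebra_simps)
  also have "\<dots> = (w * of_int E) * (u * of_int D + of_int D)"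
    unfolding eq by (simp add: algebra_simps)
  also have "\<dots> = of_int (m * (n + D))" unfolding uD wE by simp
  finally have "E * (n - D) = m * (n + D)" unfolding of_int_eq_iff .
  \<comment> \<open>The halves a - b and a + b + 1 have opposite parity, and the odd factors E and m
    cannot change this.\<close>
  then have "2 * (E * (a - b)) = 2 * (m * (a + b + 1))" unfolding ab by (simp add: algebra_simps)
  then have "even (E * (a - b)) \<longleftrightarrow> even (m * (a + b + 1))" by simp
  then show False using \<open>odd m\<close> \<open>odd E\<close> by auto
qed

end

lemma dvd_prime_powers_mult:
  fixes p q :: nat and n :: int
  assumes "prime p" "prime q" "n dvd int ((p * q) ^ l)"
  obtains s e f where "s \<in> {1, -1}" "n = s * int (p ^ e * q ^ f)"
proof -
  have "nat \<bar>n\<bar> dvd p ^ l * q ^ l"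
    using assms(3) by (simp add: power_mult_distrib nat_abs_dvd_iff)
  then obtain x y where xy: "nat \<bar>n\<bar> = x * y" "x dvd p ^ l" "y dvd q ^ l"
    by (rule dvd_productE)
  then obtain e f where "x = p ^ e" "y = q ^ f"
    using assms(1,2) by (meson divides_primepow_nat)
  then have "\<bar>n\<bar> = int (p ^ e * q ^ f)" using xy(1) by (metis abs_ge_zero nat_0_le)
  then have "n = 1 * int (p ^ e * q ^ f) \<or> n = -1 * int (p ^ e * q ^ f)" by linarith
  then show ?thesis using that by blast
qed

text \<open>Asking for all large T, and not just one, lets several units be written over the same
  denominator (p q)^T.\<close>

lemma int_adjoin_unit_prime_powers:
  fixes p q :: nat
  assumes "prime p" "prime q" "int_adjoin_unit {1 / of_nat p :: rat, 1 / of_nat q} u"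
  obtains K where "\<And>T. T \<ge> K \<Longrightarrow> \<exists>s e f. s \<in> {1, -1 :: int} \<and>
    u * of_nat ((p * q) ^ T) = of_int (s * int (p ^ e * q ^ f))"
proof -
  have pos: "p > 0" "q > 0" using assms by (auto simp: prime_gt_0_nat)
  obtain n k l where n: "u * of_nat ((p * q) ^ k) = of_int n" "n dvd int ((p * q) ^ l)"
    using int_adjoin_unit_inverse_pair_form[OF pos assms(3)] .
  obtain s e f where s: "s \<in> {1, -1}" "n = s * int (p ^ e * q ^ f)"
    using dvd_prime_powers_mult[OF assms(1,2) n(2)] .
  show ?thesis
  proof (rule that)
    fix T assume "k \<le> T"
    then obtain d where T: "T = k + d" using le_Suc_ex by blast
    have "u * of_nat ((p * q) ^ T) = u * of_nat ((p * q) ^ k) * of_nat ((p * q) ^ d)"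
      unfolding T by (simp add: power_add)
    also have "\<dots> = of_int (s * int (p ^ (e + d) * q ^ (f + d)))"
      unfolding n s by (simp add: power_add power_mult_distrib)
    finally show "\<exists>s e f. s \<in> {1, -1 :: int} \<and>
      u * of_nat ((p * q) ^ T) = of_int (s * int (p ^ e * q ^ f))"
      using s(1) by blast
  qed
qed

section \<open>From 4-cycles to primitive four-term relations\<close>

definition no_vanishing_subsum :: "(nat \<Rightarrow> int) \<Rightarrow> bool" where
  "no_vanishing_subsum a \<longleftrightarrow> (\<forall>I. I \<noteq> {} \<and> I \<subset> {1..4} \<longrightarrow> (\<Sum>i\<in>I. a i) \<noteq> 0)"

text \<open>As the total is zero, a subsum vanishes exactly when the complementary one does. This
  reduces triples to single terms and the six pairs to one from each of the three splittings into
  two pairs; {2, 3} stands for {1, 4}.\<close>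

lemma no_vanishing_subsumI:
  assumes "(\<Sum>i=1..4. a i) = 0" "\<And>i. i \<in> {1..4} \<Longrightarrow> a i \<noteq> 0"
    "a 1 + a 2 \<noteq> 0" "a 2 + a 3 \<noteq> 0" "a 1 + a 3 \<noteq> 0"
  shows "no_vanishing_subsum a"
  unfolding no_vanishing_subsum_def
proof (intro allI impI)
  fix I :: "nat set" assume I: "I \<noteq> {} \<and> I \<subset> {1..4}"
  have four: "{1..4::nat} = {1, 2, 3, 4}" by auto
  have "(\<Sum>i\<in>I. a i) = (\<Sum>i\<in>{1..4} \<inter> I. a i)" using I by (simp add: inf.absorb2 psubset_imp_subset)
  also have "\<dots> = (\<Sum>i=1..4. if i \<in> I then a i else 0)" by (simp add: sum.inter_restrict)
  also have "\<dots> = (if 1 \<in> I then a 1 else 0) + (if 2 \<in> I then a 2 else 0) +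
      (if 3 \<in> I then a 3 else 0) + (if 4 \<in> I then a 4 else 0)"
    unfolding four by simp
  finally have sum: "(\<Sum>i\<in>I. a i) = \<dots>" .
  have tot: "a 1 + a 2 + a 3 + a 4 = 0" using assms(1) unfolding four by (simp add: add.assoc)
  have nz: "a 1 \<noteq> 0" "a 2 \<noteq> 0" "a 3 \<noteq> 0" "a 4 \<noteq> 0" using assms(2) by auto
  have "\<not> (1 \<in> I \<and> 2 \<in> I \<and> 3 \<in> I \<and> 4 \<in> I)" "1 \<in> I \<or> 2 \<in> I \<or> 3 \<in> I \<or> 4 \<in> I"
    using I unfolding four by blast+
  then show "(\<Sum>i\<in>I. a i) \<noteq> 0" unfolding sum using tot nz assms(3-5)
    by (cases "1 \<in> I"; cases "2 \<in> I"; cases "3 \<in> I"; cases "4 \<in> I"; simp; linarith)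
qed

lemma no_vanishing_subsum_mult:
  assumes "no_vanishing_subsum (\<lambda>i. c * a i)"
  shows "no_vanishing_subsum a"
  unfolding no_vanishing_subsum_def
proof (intro allI impI)
  fix I :: "nat set" assume "I \<noteq> {} \<and> I \<subset> {1..4}"
  then have "(\<Sum>i\<in>I. c * a i) \<noteq> 0" using assms unfolding no_vanishing_subsum_def by blast
  then show "(\<Sum>i\<in>I. a i) \<noteq> 0" unfolding sum_distrib_left[symmetric] by auto
qed

text \<open>For distinct primes p and q, the vanishing of some \<open>e i\<close> and of some
  \<open>f i\<close> expresses that the four terms have gcd 1.\<close>

definition primitive_relation :: "nat \<Rightarrow> nat \<Rightarrow> (nat \<Rightarrow> int) \<Rightarrow> (nat \<Rightarrow> nat) \<Rightarrow> (nat \<Rightarrow> nat) \<Rightarrow> bool" where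
  "primitive_relation p q s e f \<longleftrightarrow>
     (\<forall>i\<in>{1..4}. s i \<in> {1, -1}) \<and> (\<exists>i\<in>{1..4}. e i = 0) \<and> (\<exists>i\<in>{1..4}. f i = 0) \<and>
     (\<Sum>i=1..4. s i * int (p ^ e i * q ^ f i)) = 0 \<and>
     no_vanishing_subsum (\<lambda>i. s i * int (p ^ e i * q ^ f i))"

lemma four_cycle_imp_primitive_relation:
  fixes p q :: nat
  assumes "prime p" "prime q" "odd p" "odd q"
    "has_four_cycle (int_adjoin {1 / of_nat p :: rat, 1 / of_nat q})"
  shows "\<exists>s e f. primitive_relation p q s e f"
proof -
  define S where "S = {1 / of_nat p :: rat, 1 / of_nat q}"
  have pos: "p > 0" "q > 0" using assms by (auto simp: prime_gt_0_nat)
  obtain u1 u2 u3 w where u: "int_adjoin_unit S u1" "int_adjoin_unit S u2" "int_adjoin_unit S u3"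
    and w: "int_adjoin_unit S w"
    and eqs: "1 + u1 + u2 + u3 = 0" "1 + u1 \<noteq> 0" "u1 + u2 \<noteq> 0" "u1 + u2 = (1 + u1) * w"
    using four_cycle_imp_unit_equation assms(5) unfolding S_def by blast
  have u2: "1 + u2 \<noteq> 0"
  proof
    assume "1 + u2 = 0"
    \<comment> \<open>The sum 1 + u2 belongs to two opposite sides of the cycle, so distinctness
      says nothing about it; here the oddness of p and q enters.\<close>
    then have "u1 - 1 = (1 + u1) * w" using eqs(4) by (simp add: add_eq_0_iff)
    then show False
      using odd_unit_relation_impossible[OF pos assms(3,4)] u(1) w unfolding S_def by blast
  qed
  define v where "v i = (if i = 1 then 1 else if i = 2 then u1 else if i = 3 then u2 else u3)"
    for i :: nat
  have one: "int_adjoin_unit S 1"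
    by (rule int_adjoin_unitI[of _ _ 1]) (auto intro: int_adjoin.one)
  have v: "int_adjoin_unit S (v i)" for i using u one by (simp add: v_def)
  have "\<exists>K. \<forall>T\<ge>K. \<exists>s e f. s \<in> {1, -1 :: int} \<and>
    v i * of_nat ((p * q) ^ T) = of_int (s * int (p ^ e * q ^ f))" for i
    using int_adjoin_unit_prime_powers[OF assms(1,2)] v[of i] unfolding S_def by metis
  then obtain K where K: "\<And>i T. T \<ge> K i \<Longrightarrow> \<exists>s e f. s \<in> {1, -1 :: int} \<and>
    v i * of_nat ((p * q) ^ T) = of_int (s * int (p ^ e * q ^ f))"
    by metis
  \<comment> \<open>The sum serves as a common upper bound of the four thresholds.\<close>
  define T where "T = (\<Sum>i=1..4. K i)"
  have "\<forall>i\<in>{1..4}. \<exists>s e f. s \<in> {1, -1 :: int} \<and>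
    v i * of_nat ((p * q) ^ T) = of_int (s * int (p ^ e * q ^ f))"
    unfolding T_def by (intro ballI K member_le_sum) auto
  then obtain s e f where s: "\<And>i. i \<in> {1..4} \<Longrightarrow> s i \<in> {1, -1 :: int}"
    and sef: "\<And>i. i \<in> {1..4} \<Longrightarrow> v i * of_nat ((p * q) ^ T) = of_int (s i * int (p ^ e i * q ^ f i))"
    by metis
  define M where "M = (of_nat ((p * q) ^ T) :: rat)"
  have M: "M \<noteq> 0" using pos by (simp add: M_def)
  define a where "a i = s i * int (p ^ e i * q ^ f i)" for i
  have a: "of_int (a i) = v i * M" if "i \<in> {1..4}" for i
    using sef[OF that] by (simp add: a_def M_def)
  have four: "{1..4::nat} = {1, 2, 3, 4}" by auto
  have "(of_int (\<Sum>i=1..4. a i) :: rat) = (1 + u1 + u2 + u3) * M"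
    unfolding four using a by (simp add: v_def algebra_simps)
  then have sum0: "(\<Sum>i=1..4. a i) = 0" unfolding eqs(1) by (simp only: mult_zero_left of_int_eq_0_iff)
  have nv: "no_vanishing_subsum a"
  proof (rule no_vanishing_subsumI[OF sum0])
    show "a i \<noteq> 0" if "i \<in> {1..4}" for i using s[OF that] pos by (auto simp: a_def)
    have "(of_int (a 1 + a 2) :: rat) = (1 + u1) * M" "(of_int (a 2 + a 3) :: rat) = (u1 + u2) * M"
      "(of_int (a 1 + a 3) :: rat) = (1 + u2) * M"
      using a by (simp_all add: v_def algebra_simps)
    then show "a 1 + a 2 \<noteq> 0" "a 2 + a 3 \<noteq> 0" "a 1 + a 3 \<noteq> 0"
      using eqs u2 M by (metis mult_eq_0_iff of_int_0)+
  qed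
  \<comment> \<open>Dividing by the largest common powers of p and q makes the relation
    primitive.\<close>
  define m n where "m = Min (e ` {1..4})" and "n = Min (f ` {1..4})"
  define e' f' where "e' i = e i - m" and "f' i = f i - n" for i
  have m: "e i = m + e' i" and n: "f i = n + f' i" if "i \<in> {1..4}" for i
    using that by (auto simp: e'_def f'_def m_def n_def)
  define b where "b i = s i * int (p ^ e' i * q ^ f' i)" for i
  have ab: "a i = int (p ^ m * q ^ n) * b i" if "i \<in> {1..4}" for i
    unfolding a_def b_def m[OF that] n[OF that] by (simp add: power_add)
  have "m \<in> e ` {1..4}" "n \<in> f ` {1..4}" unfolding m_def n_def by (intro Min_in; simp)+
  then have min: "\<exists>i\<in>{1..4}. e' i = 0" "\<exists>i\<in>{1..4}. f' i = 0" by (auto simp: e'_def f'_def)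
  have "int (p ^ m * q ^ n) * (\<Sum>i=1..4. b i) = 0"
    using sum0 ab by (simp add: sum_distrib_left)
  then have "(\<Sum>i=1..4. b i) = 0" using pos by simp
  moreover have "no_vanishing_subsum (\<lambda>i. int (p ^ m * q ^ n) * b i)"
    unfolding no_vanishing_subsum_def
  proof (intro allI impI)
    fix I :: "nat set" assume I: "I \<noteq> {} \<and> I \<subset> {1..4}"
    then have "(\<Sum>i\<in>I. int (p ^ m * q ^ n) * b i) = (\<Sum>i\<in>I. a i)"
      by (intro sum.cong refl ab[symmetric]) auto
    then show "(\<Sum>i\<in>I. int (p ^ m * q ^ n) * b i) \<noteq> 0"
      using nv I unfolding no_vanishing_subsum_def by simp
  qed
  then have "no_vanishing_subsum b" by (rule no_vanishing_subsum_mult)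
  ultimately have "primitive_relation p q s e' f'"
    using s min unfolding primitive_relation_def b_def[abs_def] by blast
  then show ?thesis by blast
qed

section \<open>The size bound supplied by the conjecture\<close>

text \<open>With n = 4 and epsilon = 1 the exponent 2n - 5 + epsilon is 4, and the radical of the
  product of the terms divides p q. The constant is the same for all p and q, which the later count
  over q relies on.\<close>

lemma primitive_relation_bound:
  assumes "Browkin_Brzezinski_conjecture"
  obtains C :: nat where
    "\<And>p q s e f i. primitive_relation p q s e f \<Longrightarrow> prime p \<Longrightarrow> prime q \<Longrightarrow> p \<noteq> q \<Longrightarrow>
       i \<in> {1..4} \<Longrightarrow> p ^ e i * q ^ f i \<le> C * (p * q) ^ 4"
proof -
  have "\<exists>C::real. \<forall>a :: nat \<Rightarrow> int. (\<Sum>i=1..4. a i) = 0 \<longrightarrow>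
        (\<forall>I. I \<noteq> {} \<and> I \<subset> {1..4} \<longrightarrow> (\<Sum>i\<in>I. a i) \<noteq> 0) \<longrightarrow> Gcd (a ` {1..4}) = 1 \<longrightarrow>
        real_of_int (Max ((\<lambda>i. \<bar>a i\<bar>) ` {1..4}))
          \<le> C * real_of_int (rad (\<Prod>i=1..4. a i)) powr (2 * real 4 - 5 + 1)"
    by (rule assms[unfolded Browkin_Brzezinski_conjecture_def, THEN spec, THEN mp, THEN spec, THEN mp])
      simp_all
  then obtain C :: real where C: "\<And>a :: nat \<Rightarrow> int. (\<Sum>i=1..4. a i) = 0 \<Longrightarrow>
        no_vanishing_subsum a \<Longrightarrow> Gcd (a ` {1..4}) = 1 \<Longrightarrow>
        real_of_int (Max ((\<lambda>i. \<bar>a i\<bar>) ` {1..4}))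
          \<le> C * real_of_int (rad (\<Prod>i=1..4. a i)) powr (2 * real 4 - 5 + 1)"
    unfolding no_vanishing_subsum_def by blast
  show ?thesis
  proof (rule that)
    fix p q s e f i
    assume rel: "primitive_relation p q s e f" and p: "prime p" and q: "prime q" and "p \<noteq> q"
      and i: "i \<in> {1..4::nat}"
    define a where "a i = s i * int (p ^ e i * q ^ f i)" for i
    have pos: "p > 0" "q > 0" using p q by (auto simp: prime_gt_0_nat)
    have s: "s i \<in> {1, -1}" if "i \<in> {1..4}" for i
      using rel that unfolding primitive_relation_def by blast
    have abs_a: "\<bar>a i\<bar> = int (p ^ e i * q ^ f i)" if "i \<in> {1..4}" for i
      using s[OF that] by (auto simp: a_def)
    have dvd_a: "r = p \<or> r = q" if "prime r" "int r dvd a i" "i \<in> {1..4}" for r i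
    proof -
      have "r dvd p ^ e i * q ^ f i" using that abs_a by (metis dvd_abs_iff int_dvd_int_iff)
      then show ?thesis using that p q
        by (metis prime_dvd_mult_iff prime_dvd_power primes_dvd_imp_eq)
    qed
    have ndvd_p: "\<not> p dvd q ^ k" and ndvd_q: "\<not> q dvd p ^ k" for k
      using p q \<open>p \<noteq> q\<close> by (metis prime_dvd_power primes_dvd_imp_eq)+
    \<comment> \<open>A prime dividing all terms would be p or q, but some term is free of p and
      some term is free of q.\<close>
    have "Gcd (a ` {1..4}) = 1"
    proof (rule ccontr)
      define g where "g = Gcd (a ` {1..4})"
      assume "Gcd (a ` {1..4}) \<noteq> 1"
      then have "nat g \<noteq> 1" by (auto simp: g_def)
      then obtain r where r: "prime r" "r dvd nat g" using prime_factor_nat by blast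
      have "g \<ge> 0" by (simp add: g_def)
      then have "int r dvd g" using r(2) by (metis int_dvd_int_iff nat_0_le)
      then have ra: "int r dvd a i" if "i \<in> {1..4}" for i
        using that unfolding g_def by (meson Gcd_dvd dvd_trans imageI)
      then have "r dvd p ^ e i * q ^ f i" if "i \<in> {1..4}" for i
        using that abs_a by (metis dvd_abs_iff int_dvd_int_iff)
      moreover obtain j k where "j \<in> {1..4}" "e j = 0" "k \<in> {1..4}" "f k = 0"
        using rel unfolding primitive_relation_def by blast
      ultimately have "r dvd q ^ f j" "r dvd p ^ e k"
        by (metis mult_1 power_0, metis mult_1_right power_0)
      moreover have "r = p \<or> r = q" using dvd_a[OF r(1) ra[OF i] i] .
      ultimately show False using ndvd_p ndvd_q by blast
    qed
    moreover have "(\<Sum>i=1..4. a i) = 0" "no_vanishing_subsum a"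
      using rel unfolding primitive_relation_def a_def[abs_def] by blast+
    ultimately have bound: "real_of_int (Max ((\<lambda>i. \<bar>a i\<bar>) ` {1..4}))
          \<le> C * real_of_int (rad (\<Prod>i=1..4. a i)) powr (2 * real 4 - 5 + 1)"
      by (intro C)
    define N where "N = (\<Prod>i=1..4. a i)"
    have sub: "prime_factors N \<subseteq> {int p, int q}"
    proof
      fix r assume "r \<in> prime_factors N"
      then have r: "prime r" "r dvd N" by auto
      then obtain i where "i \<in> {1..4}" "r dvd a i"
        unfolding N_def by (auto simp: prime_dvd_prod_iff)
      moreover have "r = int (nat r)" "prime (nat r)"
        using r(1) prime_ge_0_int[OF r(1)] by auto
      ultimately have "nat r = p \<or> nat r = q" using dvd_a by metis
      then show "r \<in> {int p, int q}" using \<open>r = int (nat r)\<close> by auto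
    qed
    have "rad N dvd \<Prod>{int p, int q}" unfolding rad_def
      using sub by (intro prod_dvd_prod_subset) auto
    then have "rad N \<le> int (p * q)"
      using \<open>p \<noteq> q\<close> pos by (intro zdvd_imp_le) auto
    moreover have "rad N > 0" unfolding rad_def
      by (intro prod_pos) (auto intro: prime_gt_0_int)
    ultimately have rad: "0 < real_of_int (rad N)" "real_of_int (rad N) \<le> real (p * q)"
      by (simp, metis of_int_le_iff of_int_of_nat_eq)
    have "real (p ^ e i * q ^ f i) = real_of_int \<bar>a i\<bar>" using abs_a[OF i] by simp
    also have "\<dots> \<le> real_of_int (Max ((\<lambda>i. \<bar>a i\<bar>) ` {1..4}))"
      using i by (subst of_int_le_iff, intro Max_ge) auto
    also have "\<dots> \<le> C * real_of_int (rad N) powr (2 * real 4 - 5 + 1)"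
      using bound unfolding N_def .
    also have "\<dots> = C * real_of_int (rad N) ^ 4"
      using rad(1) by (simp add: powr_numeral)
    \<comment> \<open>The constant is rounded up to a natural number, which also covers a negative
      C.\<close>
    also have "\<dots> \<le> real (nat \<lceil>C\<rceil>) * real (p * q) ^ 4"
      using rad by (intro mult_mono power_mono) (auto simp: real_nat_ceiling_ge)
    finally have "real (p ^ e i * q ^ f i) \<le> real (nat \<lceil>C\<rceil> * (p * q) ^ 4)" by simp
    then show "p ^ e i * q ^ f i \<le> nat \<lceil>C\<rceil> * (p * q) ^ 4" unfolding of_nat_le_iff .
  qed
qed

section \<open>Counting the primes q that admit a relation with bounded exponents\<close>

definition relation_poly :: "nat \<Rightarrow> (nat \<Rightarrow> int) \<Rightarrow> (nat \<Rightarrow> nat) \<Rightarrow> (nat \<Rightarrow> nat) \<Rightarrow> int poly" where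
  "relation_poly p s e f = (\<Sum>i=1..4. monom (s i * int (p ^ e i)) (f i))"

lemma poly_relation_poly:
  "poly (relation_poly p s e f) (int q) = (\<Sum>i=1..4. s i * int (p ^ e i * q ^ f i))"
  by (simp add: relation_poly_def poly_sum poly_monom mult.assoc)

text \<open>Monomials of equal degree could cancel. The constant coefficient, however, is the subsum
  over the i with \<open>f i = 0\<close>; if it is zero, all \<open>f i\<close> are zero. Modulo p
  the relation then leaves a sum of at most four signs, which is zero because p exceeds 4. This is
  again a subsum, so all \<open>e i\<close> are zero as well, and four signs with sum zero contain a
  cancelling pair.\<close>

lemma relation_poly_nonzero:
  assumes rel: "primitive_relation p q s e f" and p: "p \<ge> 5"
  shows "relation_poly p s e f \<noteq> 0"
proof
  assume 0: "relation_poly p s e f = 0"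
  define a where "a i = s i * int (p ^ e i * q ^ f i)" for i
  have nv: "I = {} \<or> I = {1..4}" if "I \<subseteq> {1..4}" "(\<Sum>i\<in>I. a i) = 0" for I
    using rel that unfolding primitive_relation_def no_vanishing_subsum_def a_def[abs_def] by blast
  have s: "s i \<in> {1, -1}" if "i \<in> {1..4}" for i
    using rel that unfolding primitive_relation_def by blast
  have "(\<Sum>i\<in>{i\<in>{1..4}. f i = 0}. a i) = (\<Sum>i\<in>{1..4}. if f i = 0 then s i * int (p ^ e i) else 0)"
    by (subst sum.inter_filter) (auto simp: a_def intro!: sum.cong)
  also have "\<dots> = coeff (relation_poly p s e f) 0"
    by (simp add: relation_poly_def coeff_sum cong: if_cong)
  finally have "(\<Sum>i\<in>{i\<in>{1..4}. f i = 0}. a i) = 0" by (simp add: 0)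
  then have "{i\<in>{1..4}. f i = 0} = {1..4}"
    using rel nv[of "{i\<in>{1..4}. f i = 0}"] unfolding primitive_relation_def by blast
  then have f: "f i = 0" if "i \<in> {1..4}" for i using that by blast
  define J where "J = {i\<in>{1..4}. e i = 0}"
  have "J \<noteq> {}" using rel unfolding J_def primitive_relation_def by blast
  have J: "J \<subseteq> {1..4}" "finite J" by (auto simp: J_def)
  have aJ: "(\<Sum>i\<in>J. a i) = (\<Sum>i\<in>J. s i)"
    by (rule sum.cong) (auto simp: J_def a_def f)
  \<comment> \<open>Outside J the exponent of p is positive.\<close>
  have "int p dvd (\<Sum>i\<in>{1..4} - J. a i)"
    by (rule dvd_sum) (auto simp: J_def a_def f)
  moreover have "(\<Sum>i\<in>{1..4}. a i) = (\<Sum>i\<in>{1..4} - J. a i) + (\<Sum>i\<in>J. a i)"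
    by (rule sum.subset_diff) (use J in auto)
  moreover have "(\<Sum>i\<in>{1..4}. a i) = 0"
    using rel unfolding primitive_relation_def a_def by blast
  ultimately have dvd: "int p dvd (\<Sum>i\<in>J. s i)"
    unfolding aJ[symmetric] by (metis dvd_add_right_iff dvd_0_right)
  have "\<bar>\<Sum>i\<in>J. s i\<bar> \<le> (\<Sum>i\<in>J. 1)"
  proof (rule order_trans[OF sum_abs sum_mono])
    show "\<bar>s i\<bar> \<le> 1" if "i \<in> J" for i
    proof -
      have "s i \<in> {1, -1}" using s J(1) that by blast
      then show ?thesis by auto
    qed
  qed
  also have "\<dots> < int p" using card_mono[OF _ J(1)] p by simp
  finally have less: "\<bar>\<Sum>i\<in>J. s i\<bar> < int p" .
  have "(\<Sum>i\<in>J. s i) = 0"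
  proof (rule ccontr)
    assume "(\<Sum>i\<in>J. s i) \<noteq> 0"
    from dvd_imp_le_int[OF this dvd] less show False by simp
  qed
  then have "J = {1..4}" using nv[OF J(1)] aJ \<open>J \<noteq> {}\<close> by simp
  then have as: "a i = s i" if "i \<in> {1..4}" for i
  proof -
    have "e i = 0" using \<open>J = {1..4}\<close> that unfolding J_def by blast
    then show ?thesis by (simp add: a_def f[OF that])
  qed
  have four: "{1..4::nat} = {1, 2, 3, 4}" by auto
  have "(\<Sum>i\<in>{1..4}. s i) = 0" using \<open>(\<Sum>i\<in>J. s i) = 0\<close> \<open>J = {1..4}\<close> by simp
  then have "s 1 + s 2 + s 3 + s 4 = 0" unfolding four by (simp add: add.assoc)
  \<comment> \<open>Three equal signs cannot be balanced by the fourth.\<close>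
  then have "s 1 + s 2 = 0 \<or> s 1 + s 3 = 0" using s[of 1] s[of 2] s[of 3] s[of 4] by auto
  then have "(\<Sum>i\<in>{1, 2}. a i) = 0 \<or> (\<Sum>i\<in>{1, 3}. a i) = 0" using as by simp
  then have "{1, 2} = {1..4::nat} \<or> {1, 3} = {1..4::nat}"
    using nv[of "{1, 2}"] nv[of "{1, 3}"] by auto
  then have "4 \<in> {1, 2::nat} \<or> 4 \<in> {1, 3::nat}" by (metis atLeastAtMost_iff le_refl one_le_numeral)
  then show False by simp
qed

lemma degree_relation_poly_le:
  assumes "\<And>i. i \<in> {1..4} \<Longrightarrow> f i \<le> L"
  shows "degree (relation_poly p s e f) \<le> L"
  unfolding relation_poly_def
  by (rule degree_sum_le) (simp, rule order_trans[OF degree_monom_le assms])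

text \<open>There are (2 (L+1)^2)^4 choices of signs and exponents, and each yields a nonzero
  polynomial with at most L roots or contributes nothing. Finiteness is stated too, since
  \<open>card\<close> of an infinite set is 0 and the bound alone would be empty.\<close>

lemma card_primitive_relation_le:
  fixes Q :: "nat set"
  assumes "p \<ge> 5"
    and Q: "\<And>q. q \<in> Q \<Longrightarrow> \<exists>s e f. primitive_relation p q s e f \<and> (\<forall>i\<in>{1..4}. e i \<le> L \<and> f i \<le> L)"
  shows "card Q \<le> (2 * (L + 1) * (L + 1)) ^ 4 * L" "finite Q"
proof -
  define B where "B = ({1, -1} \<times> {..L} \<times> {..L} :: (int \<times> nat \<times> nat) set)"
  define G where "G = PiE {1..4::nat} (\<lambda>_. B)"
  define P where "P g = relation_poly p (\<lambda>i. fst (g i)) (\<lambda>i. fst (snd (g i))) (\<lambda>i. snd (snd (g i)))"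
    for g :: "nat \<Rightarrow> int \<times> nat \<times> nat"
  \<comment> \<open>Some g in G have \<open>P g = 0\<close>; the first condition makes their root
    set empty instead of infinite. No q in Q is lost, by
    \<open>relation_poly_nonzero\<close>.\<close>
  define R where "R = (\<lambda>g. {q. P g \<noteq> 0 \<and> poly (P g) (int q) = 0})"
  have finB: "finite B" and cardB: "card B = 2 * (L + 1) * (L + 1)"
    unfolding B_def by (auto simp: card_cartesian_product)
  have finG: "finite G" unfolding G_def using finB by (intro finite_PiE) auto
  have cardG: "card G = (2 * (L + 1) * (L + 1)) ^ 4"
    unfolding G_def by (subst card_PiE) (auto simp: cardB)
  have R: "finite (R g) \<and> card (R g) \<le> L" if "g \<in> G" for g
  proof (cases "P g = 0")
    case False
    have inj: "inj_on int (R g)" by simp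
    have sub: "int ` R g \<subseteq> {x. poly (P g) x = 0}" by (auto simp: R_def)
    have fin: "finite {x. poly (P g) x = 0}" using False by (rule poly_roots_finite)
    have "card (R g) = card (int ` R g)" using card_image[OF inj] by simp
    also have "\<dots> \<le> card {x. poly (P g) x = 0}" by (rule card_mono[OF fin sub])
    also have "\<dots> \<le> degree (P g)" using False by (rule card_poly_roots_bound)
    also have "\<dots> \<le> L" unfolding P_def
    proof (rule degree_relation_poly_le)
      fix i :: nat assume "i \<in> {1..4}"
      then have "g i \<in> B" using that unfolding G_def by (rule PiE_mem[rotated])
      then show "snd (snd (g i)) \<le> L" by (auto simp: B_def)
    qed
    finally show ?thesis using finite_imageD[OF finite_subset[OF sub fin] inj] by blast
  qed (simp add: R_def)
  have "Q \<subseteq> (\<Union>g\<in>G. R g)"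
  proof
    fix q assume "q \<in> Q"
    then obtain s e f where rel: "primitive_relation p q s e f"
      and L: "\<And>i. i \<in> {1..4} \<Longrightarrow> e i \<le> L \<and> f i \<le> L"
      using Q by metis
    define g where "g = restrict (\<lambda>i. (s i, e i, f i)) {1..4::nat}"
    have "g \<in> G" unfolding G_def g_def
    proof (rule restrict_PiE_iff[THEN iffD2], rule ballI)
      fix i :: nat assume "i \<in> {1..4}"
      then show "(s i, e i, f i) \<in> B"
        using rel L[of i] unfolding primitive_relation_def B_def by blast
    qed
    moreover have Pg: "P g = relation_poly p s e f"
      unfolding P_def relation_poly_def g_def by (intro sum.cong) auto
    have "P g \<noteq> 0" unfolding Pg using relation_poly_nonzero[OF rel assms(1)] .
    moreover have "poly (P g) (int q) = 0"
      unfolding Pg poly_relation_poly using rel unfolding primitive_relation_def by blast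
    ultimately show "q \<in> (\<Union>g\<in>G. R g)" unfolding R_def by blast
  qed
  moreover have fin: "finite (\<Union>g\<in>G. R g)" using finG R by blast
  ultimately show "finite Q" by (rule finite_subset)
  have "card Q \<le> card (\<Union>g\<in>G. R g)" by (rule card_mono) fact+
  also have "\<dots> \<le> (\<Sum>g\<in>G. card (R g))" by (rule card_UN_le[OF finG])
  also have "\<dots> \<le> (\<Sum>g\<in>G. L)" using R by (intro sum_mono) blast
  also have "\<dots> = (2 * (L + 1) * (L + 1)) ^ 4 * L" using cardG by simp
  finally show "card Q \<le> (2 * (L + 1) * (L + 1)) ^ 4 * L" .
qed

section \<open>Comparison of the two counts\<close>

text \<open>Everything is compared with powers of 2: p and q are at least 2 on the left, while on
  the right q is at most 2^k and x < 2^x is applied to x = C p^4. For fixed p the bound is linear in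
  k.\<close>

lemma exponents_le:
  fixes p q C k e f :: nat
  assumes "p \<ge> 2" "q \<ge> 2" "q \<le> 2 ^ k" "p ^ e * q ^ f \<le> C * (p * q) ^ 4"
  shows "e \<le> C * p ^ 4 + 4 * k" "f \<le> C * p ^ 4 + 4 * k"
proof -
  have "2 ^ (e + f) \<le> p ^ e * q ^ f" unfolding power_add
    using assms by (intro mult_mono power_mono) auto
  also have "\<dots> \<le> C * p ^ 4 * q ^ 4" using assms(4) by (simp add: power_mult_distrib mult.assoc)
  also have "\<dots> \<le> 2 ^ (C * p ^ 4) * (2 ^ k) ^ 4"
    using assms(3) by (intro mult_mono power_mono less_imp_le[OF less_exp]) auto
  also have "\<dots> = 2 ^ (C * p ^ 4 + 4 * k)" by (simp add: power_add power_mult mult.commute)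
  finally have "e + f \<le> C * p ^ 4 + 4 * k" by simp
  then show "e \<le> C * p ^ 4 + 4 * k" "f \<le> C * p ^ 4 + 4 * k" by simp_all
qed

lemma infinite_four_cycle_free_primes:
  assumes "Browkin_Brzezinski_conjecture"
  shows "infinite {q :: nat. prime q \<and> q \<noteq> 5 \<and>
           \<not> has_four_cycle (int_adjoin {1 / of_nat 5 :: rat, 1 / of_nat q})}" (is "infinite ?A")
proof
  assume fin: "finite ?A"
  obtain C :: nat where C:
    "\<And>p q s e f i. primitive_relation p q s e f \<Longrightarrow> prime p \<Longrightarrow> prime q \<Longrightarrow> p \<noteq> q \<Longrightarrow>
       i \<in> {1..4} \<Longrightarrow> p ^ e i * q ^ f i \<le> C * (p * q) ^ 4"
    using primitive_relation_bound[OF assms] by blast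
  \<comment> \<open>The primes outside the count: those assumed to be finitely many, 2 because the
    parity argument needs q odd, and 5 because q must differ from p.\<close>
  define M where "M = card (?A \<union> {2, 5})"
  define K where "K = C * 5 ^ 4"
  define L where "L k = K + 4 * k" for k
  have main: "2 ^ k \<le> k * (M + (2 * (L k + 1) * (L k + 1)) ^ 4 * L k) + 1" for k
  proof -
    define Q where "Q = {q. prime q \<and> q \<le> 2 ^ k \<and> q \<notin> ?A \<union> {2, 5}}"
    have p5: "prime (5::nat)" by simp
    have "\<exists>s e f. primitive_relation 5 q s e f \<and> (\<forall>i\<in>{1..4}. e i \<le> L k \<and> f i \<le> L k)" if "q \<in> Q" for q
    proof -
      have q: "prime q" "q \<le> 2 ^ k" "q \<noteq> 2" "q \<noteq> 5" using that by (auto simp: Q_def)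
      then have "odd q" using primes_dvd_imp_eq two_is_prime_nat by blast
      moreover have "has_four_cycle (int_adjoin {1 / of_nat 5 :: rat, 1 / of_nat q})"
        using that by (auto simp: Q_def)
      ultimately obtain s e f where rel: "primitive_relation 5 q s e f"
        using four_cycle_imp_primitive_relation[OF p5 q(1)] by auto
      moreover have "e i \<le> L k \<and> f i \<le> L k" if "i \<in> {1..4}" for i
        using exponents_le[OF _ _ q(2) C[OF rel p5 q(1) _ that]] q prime_ge_2_nat
        by (auto simp: L_def K_def)
      ultimately show ?thesis by blast
    qed
    then have Q: "card Q \<le> (2 * (L k + 1) * (L k + 1)) ^ 4 * L k" "finite Q"
      using card_primitive_relation_le[of 5 Q "L k"] by auto
    have "card {p. prime p \<and> p \<le> (2 ^ k :: nat)} \<le> card ((?A \<union> {2, 5}) \<union> Q)"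
      using fin Q(2) by (intro card_mono) (auto simp: Q_def)
    also have "\<dots> \<le> M + card Q" unfolding M_def by (rule card_Un_le)
    finally have "card {p. prime p \<and> p \<le> (2 ^ k :: nat)} \<le> M + (2 * (L k + 1) * (L k + 1)) ^ 4 * L k"
      using Q(1) by linarith
    then show ?thesis using prime_count_two_power[of k]
      by (meson add_le_mono1 le_trans mult_le_mono2)
  qed
  \<comment> \<open>With M and K constant, the left side is a polynomial of degree 10 in k, so
    \<open>main\<close> fails for large k.\<close>
  have "eventually (\<lambda>k. real k * (real M + (2 * (real K + 4 * real k + 1) * (real K + 4 * real k + 1)) ^ 4
      * (real K + 4 * real k)) + 1 < 2 ^ k) at_top"
    by real_asymp
  then obtain k where k: "real k * (real M + (2 * (real K + 4 * real k + 1) * (real K + 4 * real k + 1)) ^ 4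
      * (real K + 4 * real k)) + 1 < 2 ^ k"
    by (meson eventually_happens' trivial_limit_sequentially)
  have "real (2 ^ k) \<le> real (k * (M + (2 * (L k + 1) * (L k + 1)) ^ 4 * L k) + 1)"
    using main of_nat_le_iff by blast
  then show False using k unfolding L_def by (simp only: of_nat_mult of_nat_add of_nat_power of_nat_numeral of_nat_1)
qed

theorem theorem1p6:
  assumes "Browkin_Brzezinski_conjecture"
  shows "infinite {(p1 :: nat, p2 :: nat). prime p1 \<and> prime p2 \<and> p1 \<noteq> p2 \<and>
           \<not> has_four_cycle (int_adjoin {1 / of_nat p1 :: rat, 1 / of_nat p2})}"
proof
  let ?B = "{(p1 :: nat, p2 :: nat). prime p1 \<and> prime p2 \<and> p1 \<noteq> p2 \<and>
           \<not> has_four_cycle (int_adjoin {1 / of_nat p1 :: rat, 1 / of_nat p2})}"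
  assume "finite ?B"
  \<comment> \<open>The second projection of \<open>?B\<close> contains the infinite set of primes q
    found for p1 = 5.\<close>
  then have "finite (snd ` ?B)" by (rule finite_imageI)
  then have "finite {q :: nat. prime q \<and> q \<noteq> 5 \<and>
           \<not> has_four_cycle (int_adjoin {1 / of_nat 5 :: rat, 1 / of_nat q})}"
  proof (rule rev_finite_subset, intro subsetI)
    fix q :: nat
    assume "q \<in> {q. prime q \<and> q \<noteq> 5 \<and>
      \<not> has_four_cycle (int_adjoin {1 / of_nat 5 :: rat, 1 / of_nat q})}"
    moreover have "prime (5 :: nat)" by simp
    ultimately have "(5, q) \<in> ?B" by blast
    then have "snd (5 :: nat, q) \<in> snd ` ?B" by (rule imageI)
    then show "q \<in> snd ` ?B" by (simp only: snd_conv)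
  qed
  then show False using infinite_four_cycle_free_primes[OF assms] by contradiction
qed

end
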